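(* Let $m<n$ be nonnegative integers with $n\ge1$ and let $a_1,\dots,a_n$ be nonnegative integers. Then \[ \mathrm{CT}\Bigg[\prod_{1\le i<j\le n}\left(\frac{x_i}{x_j}\right)_{a_i}\left(\frac{qx_j}{x_i}\right)_{a_j^*}\Bigg]=\frac{1-q^{1+|\mathbf a|}}{1-q^{1+\sum_{v=m+1}^n a_v}}\begin{bmatrix}|\mathbf a|\\ \mathbf a\end{bmatrix}_q, \] where for a pair $i<j$ we set $a_j^*=a_n+\chi(i\le m)$ if $j=n$, and $a_j^*=a_j$ otherwise.
   Context: $q$ and $x_1,\dots,x_n$ are independent indeterminates; the expression is a Laurent polynomial in $x_1,\dots,x_n$ with coefficients in $\mathbb{Q}(q)$, and $\mathrm{CT}$ denotes its constant term with respect to $x_1,\dots,x_n$. $(t)_k=(1-t)(1-tq)\cdots(1-tq^{k-1})$ (with $(t)_0=1$). $|\mathbf a|=a_1+\dots+a_n$ and $\begin{bmatrix}|\mathbf a|\\ \mathbf a\end{bmatrix}_q=\frac{(q)_{|\mathbf a|}}{(q)_{a_1}\cdots(q)_{a_n}}$. $\chi(S)$ equals $1$ if statement $S$ is true and $0$ otherwise. *)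

theory Defs
  imports
    "HOL-Library.Poly_Mapping"
    "HOL-Computational_Algebra.Polynomial"
    "HOL-Computational_Algebra.Fraction_Field"
begin

type_synonym ratfun = "rat poly fract"

definition qvar :: ratfun where
  "qvar = Fract [:0, 1:] 1"

text \<open>
  Laurent polynomials in the indeterminates \<open>x i\<close>, \<open>i :: nat\<close>, as a monoid algebra: an exponent
  vector is a finitely supported function from indices to integers, and a Laurent polynomial is a
  finitely supported function from exponent vectors to coefficients, multiplied by convolution.
\<close>

type_synonym 'c laurent_mpoly = "(nat \<Rightarrow>\<^sub>0 int) \<Rightarrow>\<^sub>0 'c"

definition const_lp :: "'c::comm_ring_1 \<Rightarrow> 'c laurent_mpoly" where
  "const_lp c = Poly_Mapping.single 0 c"

definition var_lp :: "nat \<Rightarrow> 'c::comm_ring_1 laurent_mpoly" where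
  "var_lp i = Poly_Mapping.single (Poly_Mapping.single i 1) 1"

definition var_inv_lp :: "nat \<Rightarrow> 'c::comm_ring_1 laurent_mpoly" where
  "var_inv_lp i = Poly_Mapping.single (Poly_Mapping.single i (- 1)) 1"

lemma var_lp_mult_var_inv_lp: "var_lp i * var_inv_lp i = 1"
  by (simp add: var_lp_def var_inv_lp_def mult_single flip: single_add)

definition constant_term :: "'c::comm_ring_1 laurent_mpoly \<Rightarrow> 'c" where
  "constant_term p = Poly_Mapping.lookup p 0"

definition qpoch :: "'r::comm_ring_1 \<Rightarrow> 'r \<Rightarrow> nat \<Rightarrow> 'r" where
  "qpoch q t k = (\<Prod>l<k. 1 - t * q ^ l)"

definition qmultinomial :: "nat \<Rightarrow> (nat \<Rightarrow> nat) \<Rightarrow> ratfun" where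
  "qmultinomial n a = qpoch qvar qvar (\<Sum>i=1..n. a i) / (\<Prod>i=1..n. qpoch qvar qvar (a i))"

definition astar :: "nat \<Rightarrow> nat \<Rightarrow> (nat \<Rightarrow> nat) \<Rightarrow> nat \<Rightarrow> nat \<Rightarrow> nat" where
  "astar m n a i j = (if j = n then a n + of_bool (i \<le> m) else a j)"

end

theory Submission imports Defs "HOL-Library.FuncSet" begin

text \<open>
  The constant term is read off by interpolation, following Karolyi and Nagy. In every monomial of
  the product the exponents sum to 0 and the exponent of \<open>x i\<close> is at least \<open>- d i\<close>, where
  \<open>d i = |a| - a i + \<chi>(i \<le> m)\<close>. Lagrange interpolation on a grid with \<open>d i + 1\<close> nodes for \<open>x i\<close>
  therefore expresses the constant term as a weighted sum of the values at the grid points. On the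
  grid \<open>x i \<in> {1, q, \<dots>, q ^ d i}\<close> a point \<open>x i = q ^ al i\<close> with nonzero value has large gaps: sorting
  the indices by \<open>(al i, i)\<close>, the step from \<open>i\<close> to its successor \<open>j\<close> is at least \<open>a i\<close>, plus 1 if
  \<open>i > j\<close>, plus another 1 if moreover \<open>i = n\<close> and \<open>j \<le> m\<close>. The available range forces the sorted
  order to be \<open>1, \<dots>, n\<close> and \<open>al i = a 1 + \<dots> + a (i - 1)\<close>, and at this single point the product
  telescopes.
\<close>

subsection \<open>Lagrange interpolation and evaluation of Laurent polynomials\<close>

text \<open>The polynomial \<open>z ^ (b + d)\<close> has degree at most \<open>d\<close>, so it
  equals its Lagrange interpolant on the \<open>d + 1\<close> nodes; comparing coefficients of
  \<open>z ^ d\<close> gives the sum. Dividing every factor \<open>c - y\<close> by \<open>c\<close>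
  turns the exponent \<open>b + d\<close> back into \<open>b\<close>.\<close>

lemma lagrange_powi_sum:
  fixes C :: "'c::field set" and b :: int
  assumes "finite C" "0 \<notin> C" "card C = Suc d" "- int d \<le> b" "b \<le> 0"
  shows "(\<Sum>c\<in>C. c powi b / (\<Prod>y\<in>C-{c}. 1 - y / c)) = of_bool (b = 0)"
proof -
  define e where "e = nat (b + int d)"
  have e: "e \<le> d" "int e = b + int d" using assms by (auto simp: e_def)
  define L where "L c = (\<Prod>y\<in>C-{c}. [:- y, 1:])" for c
  define D where "D c = (\<Prod>y\<in>C-{c}. c - y)" for c
  have cardm: "card (C - {c}) = d" if "c \<in> C" for c
    using assms that by simp
  have L_poly: "poly (L c) z = (\<Prod>y\<in>C-{c}. z - y)" for c z
    by (simp add: L_def poly_prod)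
  have degL: "degree (L c) = d" if "c \<in> C" for c
    unfolding L_def using cardm[OF that] by (subst degree_prod_eq_sum_degree) auto
  have coeffL: "coeff (L c) d = 1" if "c \<in> C" for c
    using lead_coeff_prod[of "\<lambda>y. [:- y, 1:]" "C - {c}"] degL[OF that]
    by (simp add: L_def)
  have D_nz: "D c \<noteq> 0" if "c \<in> C" for c
    using assms(1) by (auto simp: D_def)
  define P where "P = (\<Sum>c\<in>C. smult (c ^ e / D c) (L c))"
  have "P = monom 1 e"
  proof (rule poly_eqI_degree[of C])
    fix z assume z: "z \<in> C"
    have "poly P z = (\<Sum>c\<in>C. if c = z then z ^ e else 0)"
      unfolding P_def poly_sum
    proof (rule sum.cong[OF refl])
      fix c assume c: "c \<in> C"
      show "poly (smult (c ^ e / D c) (L c)) z = (if c = z then z ^ e else 0)"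
      proof (cases "c = z")
        case True
        then show ?thesis using D_nz[OF z] by (simp add: L_poly D_def)
      next
        case False
        then have "poly (L c) z = 0" using z assms(1) by (auto simp: L_poly)
        then show ?thesis using False by simp
      qed
    qed
    then show "poly P z = poly (monom 1 e) z" using z assms(1) by (simp add: poly_monom)
  next
    have "degree P \<le> d" unfolding P_def
      by (rule degree_sum_le[OF assms(1)]) (metis degL degree_smult_le)
    then show "degree P < card C" using assms by simp
  next
    show "degree (monom (1::'c) e) < card C" using e assms by (simp add: degree_monom_eq)
  qed
  moreover have "coeff P d = (\<Sum>c\<in>C. c ^ e / D c)"
    unfolding P_def coeff_sum by (rule sum.cong) (auto simp: coeffL)
  ultimately have main: "(\<Sum>c\<in>C. c ^ e / D c) = of_bool (e = d)"
    by (simp only: coeff_monom of_bool_def)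
  have "(\<Sum>c\<in>C. c powi b / (\<Prod>y\<in>C-{c}. 1 - y / c)) = (\<Sum>c\<in>C. c ^ e / D c)"
  proof (rule sum.cong[OF refl])
    fix c assume c: "c \<in> C"
    then have c0: "c \<noteq> 0" using assms by auto
    have "D c = (\<Prod>y\<in>C-{c}. c * (1 - y / c))"
      unfolding D_def using c0 by (intro prod.cong) (auto simp: field_simps)
    also have "\<dots> = c ^ d * (\<Prod>y\<in>C-{c}. 1 - y / c)"
      using cardm[OF c] by (simp add: prod.distrib)
    finally have 1: "D c = c ^ d * (\<Prod>y\<in>C-{c}. 1 - y / c)" .
    have "c powi int e = c powi b * c powi int d"
      unfolding e(2) using c0 by (simp add: power_int_add)
    then have "c ^ e = c powi b * c ^ d" by simp
    then show "c powi b / (\<Prod>y\<in>C-{c}. 1 - y / c) = c ^ e / D c"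
      unfolding 1 using c0 by simp
  qed
  also have "\<dots> = of_bool (b = 0)" using main e by auto
  finally show ?thesis .
qed

section \<open>Evaluation of Laurent polynomials at points with nonzero coordinates\<close>

definition monom_eval :: "nat set \<Rightarrow> (nat \<Rightarrow> 'c::field) \<Rightarrow> (nat \<Rightarrow>\<^sub>0 int) \<Rightarrow> 'c" where
  "monom_eval I x b = (\<Prod>i\<in>I. x i powi Poly_Mapping.lookup b i)"

definition laurent_eval :: "nat set \<Rightarrow> (nat \<Rightarrow> 'c::field) \<Rightarrow> 'c laurent_mpoly \<Rightarrow> 'c" where
  "laurent_eval I x p = (\<Sum>b\<in>Poly_Mapping.keys p. Poly_Mapping.lookup p b * monom_eval I x b)"

lemma monom_eval_add:
  assumes "\<And>i. i \<in> I \<Longrightarrow> x i \<noteq> 0"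
  shows "monom_eval I x (b + c) = monom_eval I x b * monom_eval I x c"
  using assms by (simp add: monom_eval_def lookup_add power_int_add prod.distrib)

lemma laurent_eval_superset:
  assumes "finite B" "Poly_Mapping.keys p \<subseteq> B"
  shows "laurent_eval I x p = (\<Sum>b\<in>B. Poly_Mapping.lookup p b * monom_eval I x b)"
  unfolding laurent_eval_def
  by (rule sum.mono_neutral_left) (use assms in \<open>auto simp: in_keys_iff\<close>)

lemma laurent_eval_add: "laurent_eval I x (p + r) = laurent_eval I x p + laurent_eval I x r"
proof -
  let ?B = "Poly_Mapping.keys p \<union> Poly_Mapping.keys r"
  have "Poly_Mapping.keys (p + r) \<subseteq> ?B" by (rule keys_add)
  then show ?thesis
    by (simp add: laurent_eval_superset[of ?B] lookup_add distrib_right sum.distrib)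
qed

lemma laurent_eval_single [simp]:
  "laurent_eval I x (Poly_Mapping.single b c) = c * monom_eval I x b"
  by (simp add: laurent_eval_def)

lemma laurent_eval_0 [simp]: "laurent_eval I x 0 = 0"
  by (simp add: laurent_eval_def)

lemma laurent_eval_1 [simp]: "laurent_eval I x 1 = 1"
  by (simp add: monom_eval_def flip: single_one)

lemma laurent_eval_diff: "laurent_eval I x (p - r) = laurent_eval I x p - laurent_eval I x r"
  using laurent_eval_add[of I x "p - r" r] by simp

lemma poly_mapping_induct [case_names zero single add]:
  assumes "P 0" "\<And>k v. P (Poly_Mapping.single k v)" "\<And>p r. P p \<Longrightarrow> P r \<Longrightarrow> P (p + r)"
  shows "P p"
proof (induction p rule: update_induct)
  case const
  show ?case by (rule assms)
next
  case (update f k v)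
  have "Poly_Mapping.update k v f = f + Poly_Mapping.single k v"
    using update by (intro poly_mapping_eqI) (auto simp: lookup_update lookup_add lookup_single when_def in_keys_iff)
  then show ?case using update assms by simp
qed

text \<open>Both sides are additive in each factor, which leaves monomials; there, nonzero
  coordinates make integer powers turn sums of exponents into products.\<close>

lemma laurent_eval_mult:
  assumes "\<And>i. i \<in> I \<Longrightarrow> x i \<noteq> 0"
  shows "laurent_eval I x (p * r) = laurent_eval I x p * laurent_eval I x r"
proof (induction p rule: poly_mapping_induct)
  case zero
  show ?case by simp
next
  case (single b c)
  show ?case
    by (induction r rule: poly_mapping_induct)
      (simp_all add: mult_single monom_eval_add[OF assms] laurent_eval_add distrib_left)
next
  case (add p p')
  then show ?case by (simp add: distrib_right laurent_eval_add)
qed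

lemma laurent_eval_prod:
  assumes "\<And>i. i \<in> I \<Longrightarrow> x i \<noteq> 0"
  shows "laurent_eval I x (\<Prod>k\<in>K. f k) = (\<Prod>k\<in>K. laurent_eval I x (f k))"
  by (induction K rule: infinite_finite_induct) (simp_all add: laurent_eval_mult[OF assms])

lemma const_lp_power: "const_lp c ^ k = const_lp (c ^ k)"
  by (induction k) (simp_all add: const_lp_def mult_single)

lemma laurent_eval_const [simp]: "laurent_eval I x (const_lp c) = c"
  by (simp add: const_lp_def monom_eval_def)

lemma laurent_eval_var:
  assumes "finite I" "i \<in> I"
  shows "laurent_eval I x (var_lp i) = x i" "laurent_eval I x (var_inv_lp i) = inverse (x i)"
proof -
  have *: "(\<Prod>j\<in>I. x j powi (if j = i then k else 0)) = x i powi k" for k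
    using assms by (subst prod.mono_neutral_cong_right[of I "{i}" _ "\<lambda>j. x i powi k"]) auto
  show "laurent_eval I x (var_lp i) = x i" "laurent_eval I x (var_inv_lp i) = inverse (x i)"
    by (simp_all add: var_lp_def var_inv_lp_def monom_eval_def lookup_single when_def * eq_commute[of i])
qed

lemma laurent_eval_qpoch:
  assumes "\<And>i. i \<in> I \<Longrightarrow> x i \<noteq> 0"
  shows "laurent_eval I x (qpoch (const_lp c) t k) = qpoch c (laurent_eval I x t) k"
  by (simp add: qpoch_def laurent_eval_prod[OF assms] laurent_eval_diff
      laurent_eval_mult[OF assms] const_lp_power)

subsection \<open>The only grid point with nonzero value\<close>

text \<open>
  \<open>G R p\<close> is a potential for the surplus collected by the extra gaps \<open>e\<close> on the way to the
  largest-ranked element \<open>p\<close> of \<open>R\<close>.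
\<close>

lemma ranked_gap_bound:
  fixes al a :: "nat \<Rightarrow> nat" and key :: "nat \<Rightarrow> nat"
  assumes "finite S" "inj_on key S"
    and gap: "\<And>i j. i \<in> S \<Longrightarrow> j \<in> S \<Longrightarrow> key i < key j \<Longrightarrow> al i + a i + e i j \<le> al j"
    and low: "\<And>i. i \<in> S \<Longrightarrow> L \<le> al i"
    and G1: "\<And>p. G {p} p = 0"
    and G2: "\<And>R p p'. insert p' R \<subseteq> S \<Longrightarrow> p \<in> R \<Longrightarrow> p' \<notin> R \<Longrightarrow> G (insert p' R) p' \<le> G R p + e p p'"
    and p: "p \<in> S" "\<And>i. i \<in> S \<Longrightarrow> key i \<le> key p"
  shows "L + sum a (S - {p}) + G S p \<le> al p"
proof -
  \<comment> \<open>\<open>R\<close> is built up one element at a time in increasing order of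
    \<open>key\<close>, the new element always ranking highest.\<close>
  have "R \<subseteq> S \<Longrightarrow> p \<in> R \<Longrightarrow> (\<forall>i\<in>R. key i \<le> key p) \<Longrightarrow> L + sum a (R - {p}) + G R p \<le> al p"
    if "finite R" for R p
    using that
  proof (induction R arbitrary: p rule: finite_ranking_induct[where f = key])
    case empty
    then show ?case by simp
  next
    case (insert x R)
    show ?case
    proof (cases "x \<in> R")
      case True
      then show ?thesis using insert by (simp add: insert_absorb)
    next
      case False
      have px: "p = x"
      proof (rule ccontr)
        assume "p \<noteq> x"
        then have "key p = key x" using insert by (intro antisym) auto
        then show False using \<open>p \<noteq> x\<close> insert.prems assms(2) by (auto dest: inj_onD)
      qed
      show ?thesis
      proof (cases "R = {}")
        case True
        then show ?thesis using px low[of x] insert.prems G1 by simp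
      next
        case ne: False
        \<comment> \<open>\<open>r\<close> directly precedes \<open>x\<close> in the order, so only
          the gap from \<open>r\<close> to \<open>x\<close> is added; it supplies
          \<open>a r\<close>, which the bound at \<open>r\<close> leaves out.\<close>
        obtain r where r: "r \<in> R" "\<And>i. i \<in> R \<Longrightarrow> key i \<le> key r"
          using ne insert.hyps(1) obtains_MAX[of R key]
          by (metis Max_ge finite_imageI imageI)
        have IH: "L + sum a (R - {r}) + G R r \<le> al r"
          using insert.IH[of r] r insert.prems by auto
        have "key r \<noteq> key x" using False r insert.prems assms(2) by (auto dest: inj_onD)
        then have "key r < key x" using insert.hyps(2)[OF r(1)] by simp
        then have "al r + a r + e r x \<le> al x" using gap r insert.prems by auto
        moreover have "G (insert x R) x \<le> G R r + e r x" using G2 r insert.prems False by auto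
        moreover have "sum a (insert x R - {x}) = a r + sum a (R - {r})"
          using False r insert.hyps(1) by (simp add: sum.remove)
        ultimately show ?thesis using IH px by simp
      qed
    qed
  qed
  then show ?thesis using assms(1) p by auto
qed

text \<open>With \<open>a i\<close> itself left out, these are the exponents of the surviving grid
  point, and \<open>psum a (Suc n)\<close> is the full sum.\<close>

definition psum :: "(nat \<Rightarrow> nat) \<Rightarrow> nat \<Rightarrow> nat" where
  "psum a i = (\<Sum>j=1..<i. a j)"

text \<open>The hypothesis \<open>sep\<close> is what nonvanishing of the factors at a grid point
  gives, and \<open>ub\<close> reflects the size of the grid. Adding up gaps shows in turn that
  \<open>n\<close> ranks last, that no descent occurs because \<open>n\<close> has no slack left,
  and that the chains below and above \<open>k\<close> then pin down \<open>al k\<close>.\<close>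

lemma separated_exponents_unique:
  fixes al a :: "nat \<Rightarrow> nat"
  assumes "m < n"
    and sep: "\<And>i j. 1 \<le> i \<Longrightarrow> i < j \<Longrightarrow> j \<le> n \<Longrightarrow>
      al i + a i \<le> al j \<or> al j + astar m n a i j + 1 \<le> al i"
    and ub: "\<And>i. i \<in> {1..n} \<Longrightarrow> al i + a i \<le> (\<Sum>v=1..n. a v) + of_bool (i \<le> m)"
    and k: "k \<in> {1..n}"
  shows "al k = psum a k"
proof -
  define A where "A = (\<Sum>v=1..n. a v)"
  \<comment> \<open>For indices up to \<open>n\<close> this number encodes the lexicographic order
    on \<open>(al i, i)\<close>, so ties in \<open>al\<close> are broken by the index.\<close>
  define key where "key i = al i * Suc n + i" for i
  define e where "e i j = (if i < j then 0 else 1 + of_bool (i = n \<and> j \<le> m) :: nat)" for i j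
  have key_less: "al i < al j \<or> al i = al j \<and> i < j" if "key i < key j" "i \<le> n" "j \<le> n" for i j
  proof (rule ccontr)
    assume c: "\<not> ?thesis"
    show False
    proof (cases "al i = al j")
      case True
      then show ?thesis using c that by (simp add: key_def)
    next
      case False
      then have "Suc (al j) * Suc n \<le> al i * Suc n" using c by (intro mult_le_mono1) simp
      then show ?thesis using that by (simp add: key_def)
    qed
  qed
  have inj: "inj_on key {1..n}"
  proof (rule inj_onI)
    fix i j assume ij: "i \<in> {1..n}" "j \<in> {1..n}" "key i = key j"
    then have "key i mod Suc n = key j mod Suc n" by simp
    then show "i = j" using ij by (simp add: key_def del: mult_Suc_right)
  qed
  have gap: "al i + a i + e i j \<le> al j" if "i \<in> {1..n}" "j \<in> {1..n}" "key i < key j" for i j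
  proof (cases "i < j")
    case True
    then show ?thesis using sep[of i j] key_less[of i j] that by (auto simp: e_def)
  next
    case False
    moreover have "i \<noteq> j" using that by auto
    ultimately show ?thesis using sep[of j i] key_less[of i j] that
      by (auto simp: e_def astar_def split: if_splits)
  qed
  have rem: "sum a ({1..n} - {i}) + a i = A" if "i \<in> {1..n}" for i
    using that by (simp add: A_def sum.remove)
  obtain p where p: "p \<in> {1..n}" "\<And>i. i \<in> {1..n} \<Longrightarrow> key i \<le> key p"
    using k obtains_MAX[of "{1..n}" key] by (metis Max_ge empty_iff finite_atLeastAtMost finite_imageI imageI)
  \<comment> \<open>A descent is needed to leave \<open>n\<close>, and reaching \<open>p \<le> m\<close> afterwards costs a surplus of 2: either
    \<open>n\<close> is followed by some \<open>j \<le> m\<close>, or there is a second descent.\<close>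
  define G where "G R p = (if n \<in> R \<and> p \<noteq> n then (if p \<le> m then 2 else 1) else 0 :: nat)" for R p
  have "0 + sum a ({1..n} - {p}) + G {1..n} p \<le> al p"
    by (rule ranked_gap_bound[where key = key and e = e])
      (use inj gap p assms(1) in \<open>auto simp: G_def e_def\<close>)
  \<comment> \<open>If \<open>p \<noteq> n\<close>, the surplus is
    \<open>1 + of_bool (p \<le> m)\<close>, one more than \<open>ub\<close> allows.\<close>
  then have "p = n" using rem[OF p(1)] ub[OF p(1)] p(1)
    by (auto simp: G_def A_def split: if_splits)
  have n: "n \<in> {1..n}" using k by auto
  have aln: "al n + a n \<le> A" using ub[OF n] assms(1) by (simp add: A_def)
  have max: "key i \<le> key n" if "i \<in> {1..n}" for i using p that \<open>p = n\<close> by simp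
  \<comment> \<open>This is the chain from \<open>i\<close> up to \<open>n\<close>, with
    \<open>al i\<close> itself as the lower bound \<open>L\<close>. The vanishing last summand below
    takes the potential of \<open>ranked_gap_bound\<close> to be zero.\<close>
  have upper: "al i + sum a ({j\<in>{1..n}. key i \<le> key j} - {n}) \<le> al n" if i: "i \<in> {1..n}" for i
  proof -
    have "al i + sum a ({j\<in>{1..n}. key i \<le> key j} - {n}) + (\<lambda>_ _. 0) {} n \<le> al n"
    proof (rule ranked_gap_bound[where key = key and e = e])
      show "al i \<le> al j" if "j \<in> {j \<in> {1..n}. key i \<le> key j}" for j
        using gap[of i j] inj_onD[OF inj, of i j] that i by (cases "key i = key j") auto
      show "inj_on key {j \<in> {1..n}. key i \<le> key j}" by (rule inj_on_subset[OF inj]) auto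
    qed (use gap n max i in auto)
    then show ?thesis by simp
  qed
  have mono: "key i < key j" if ij: "i \<in> {1..n}" "j \<in> {1..n}" "i < j" for i j
  proof (rule ccontr)
    assume "\<not> key i < key j"
    moreover have "key i \<noteq> key j" using inj_onD[OF inj, of i j] ij by auto
    ultimately have lt: "key j < key i" by simp
    let ?S = "{j\<in>{1..n}. key j \<le> key i}"
    \<comment> \<open>An index in \<open>R\<close> larger than the top-ranked one can only be left
      behind by a descent, so this potential certifies an extra 1 on the way to
      \<open>i\<close>.\<close>
    define G where "G R p = (of_bool (\<exists>j\<in>R. j > p) :: nat)" for R and p :: nat
    have bound: "0 + sum a (?S - {i}) + G ?S i \<le> al i"
    proof (rule ranked_gap_bound[where key = key and e = e])
      show "inj_on key ?S" by (rule inj_on_subset[OF inj]) auto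
      fix R :: "nat set" and p p' assume "p \<in> R" "p' \<notin> R"
      then show "G (insert p' R) p' \<le> G R p + e p p'"
        by (cases "p < p'") (auto simp: G_def e_def intro: less_trans)
    qed (use gap ij in \<open>auto simp: G_def\<close>)
    have "j \<in> ?S" using lt ij by simp
    then have "G ?S i = 1" using ij(3) unfolding G_def by (simp only: of_bool_eq_1_iff) blast
    with bound have "sum a (?S - {i}) + 1 \<le> al i" by simp
    moreover have "al i + sum a ({j\<in>{1..n}. key i \<le> key j} - {n}) \<le> al n" using upper ij by simp
    \<comment> \<open>The two chains meet at \<open>i\<close>, and \<open>a i\<close> is counted
      only in the upper one. Together with the extra 1 they push \<open>al n + a n\<close> above
      \<open>A\<close>.\<close>
    moreover have "sum a ({1..n} - {n}) = sum a (?S - {i}) + sum a ({j\<in>{1..n}. key i \<le> key j} - {n})"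
    proof -
      have "{1..n} - {n} = (?S - {i}) \<union> ({j\<in>{1..n}. key i \<le> key j} - {n})"
        using ij max[of i] inj_onD[OF inj, of n i] by fastforce
      moreover have "(?S - {i}) \<inter> ({j\<in>{1..n}. key i \<le> key j} - {n}) = {}"
        using inj_onD[OF inj, of _ i] ij by fastforce
      ultimately show ?thesis by (simp add: sum.union_disjoint)
    qed
    ultimately show False using rem[OF n] aln by simp
  qed
  \<comment> \<open>Now that the order is known to be \<open>1, ..., n\<close>, the indices below
    \<open>k\<close> bound \<open>al k\<close> from below by \<open>psum a k\<close>; those from
    \<open>k\<close> on bound it from above through \<open>aln\<close>.\<close>
  have "0 + sum a ({1..k} - {k}) + (\<lambda>_ _. 0) {} k \<le> al k"
  proof (rule ranked_gap_bound[where key = key and e = e])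
    show "inj_on key {1..k}" by (rule inj_on_subset[OF inj]) (use k in auto)
    show "key i \<le> key k" if "i \<in> {1..k}" for i
      using mono[of i k] that k by (cases "i = k") auto
  qed (use gap k in auto)
  moreover have "{1..k} - {k} = {1..<k}" by auto
  ultimately have 1: "psum a k \<le> al k" by (simp add: psum_def)
  have "key k \<le> key j \<longleftrightarrow> k \<le> j" if "j \<in> {1..n}" for j
    using mono[of k j] mono[of j k] k that by (cases k j rule: linorder_cases) auto
  then have "{j\<in>{1..n}. key k \<le> key j} = {k..n}"
    using k by auto
  then have 2: "al k + sum a ({k..n} - {n}) \<le> al n" using upper[OF k] by simp
  have "{1..n} - {n} = {1..<k} \<union> ({k..n} - {n})" using k by auto
  moreover have "{1..<k} \<inter> ({k..n} - {n}) = {}" by auto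
  ultimately have "sum a ({1..n} - {n}) = psum a k + sum a ({k..n} - {n})"
    by (simp add: sum.union_disjoint psum_def)
  then show ?thesis using 1 2 aln rem[OF n] by simp
qed

subsection \<open>The constant term by interpolation\<close>

text \<open>Lower bounds on the exponents suffice: since the exponents sum to 0, a nonzero exponent
  vector has a negative entry, and that entry alone makes its interpolation sum vanish.\<close>

definition balanced :: "nat \<Rightarrow> (nat \<Rightarrow> nat) \<Rightarrow> 'c::comm_ring_1 laurent_mpoly \<Rightarrow> bool" where
  "balanced n d p \<longleftrightarrow> (\<forall>b\<in>Poly_Mapping.keys p. Poly_Mapping.keys b \<subseteq> {1..n} \<and>
     (\<Sum>i=1..n. Poly_Mapping.lookup b i) = 0 \<and> (\<forall>i. - int (d i) \<le> Poly_Mapping.lookup b i))"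

lemma balanced_1: "balanced n (\<lambda>_. 0) 1"
  by (simp add: balanced_def)

lemma balanced_mult:
  assumes "balanced n d p" "balanced n d' r"
  shows "balanced n (\<lambda>i. d i + d' i) (p * r)"
  unfolding balanced_def
proof
  fix b assume "b \<in> Poly_Mapping.keys (p * r)"
  then obtain u v where b: "b = u + v" "u \<in> Poly_Mapping.keys p" "v \<in> Poly_Mapping.keys r"
    using keys_mult[of p r] by blast
  have "Poly_Mapping.keys b \<subseteq> {1..n}"
    using keys_add[of u v] assms b unfolding balanced_def by blast
  moreover have "(\<Sum>i=1..n. Poly_Mapping.lookup b i) = 0"
    using assms b by (simp add: balanced_def lookup_add sum.distrib)
  moreover have "- int (d i + d' i) \<le> Poly_Mapping.lookup b i" for i
  proof -
    have "- int (d i) \<le> Poly_Mapping.lookup u i" "- int (d' i) \<le> Poly_Mapping.lookup v i"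
      using assms b by (auto simp: balanced_def)
    then show ?thesis by (simp add: b lookup_add)
  qed
  ultimately show "Poly_Mapping.keys b \<subseteq> {1..n} \<and> (\<Sum>i=1..n. Poly_Mapping.lookup b i) = 0 \<and>
      (\<forall>i. - int (d i + d' i) \<le> Poly_Mapping.lookup b i)" by blast
qed

lemma balanced_prod:
  assumes "\<And>k. k \<in> K \<Longrightarrow> balanced n (d k) (f k)"
  shows "balanced n (\<lambda>i. \<Sum>k\<in>K. d k i) (\<Prod>k\<in>K. f k)"
  using assms
  by (induction K rule: infinite_finite_induct) (simp_all add: balanced_1 balanced_mult)

lemma balanced_linear_factor:
  assumes "i \<in> {1..n}" "j \<in> {1..n}" "i \<noteq> j"
  shows "balanced n (\<lambda>k. of_bool (k = j)) (1 - var_lp i * var_inv_lp j * const_lp c)"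
proof -
  let ?b = "Poly_Mapping.single i 1 + Poly_Mapping.single j (- 1) :: nat \<Rightarrow>\<^sub>0 int"
  have eq: "var_lp i * var_inv_lp j * const_lp c = Poly_Mapping.single ?b c"
    by (simp add: var_lp_def var_inv_lp_def const_lp_def mult_single)
  have "Poly_Mapping.keys (1 - var_lp i * var_inv_lp j * const_lp c) \<subseteq> {0, ?b}"
    unfolding eq using keys_diff[of 1 "Poly_Mapping.single ?b c"] by (auto split: if_splits)
  moreover have "Poly_Mapping.keys ?b \<subseteq> {1..n}"
    using keys_add[of "Poly_Mapping.single i (1::int)" "Poly_Mapping.single j (- 1)"] assms by auto
  moreover have "(\<Sum>k=1..n. Poly_Mapping.lookup ?b k) = 0"
    using assms by (simp add: lookup_add lookup_single when_def sum.distrib)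
  moreover have "- int (of_bool (k = j)) \<le> Poly_Mapping.lookup ?b k" for k
    using assms by (auto simp: lookup_add lookup_single when_def)
  ultimately show ?thesis unfolding balanced_def by fastforce
qed

text \<open>The factor \<open>c\<close> lets this serve both Pochhammer symbols of a pair, with
  \<open>c\<close> equal to 1 and to \<open>q\<close>.\<close>

lemma balanced_qpoch:
  assumes "i \<in> {1..n}" "j \<in> {1..n}" "i \<noteq> j"
  shows "balanced n (\<lambda>k. N * of_bool (k = j)) (qpoch (const_lp q) (const_lp c * var_lp i * var_inv_lp j) N)"
proof -
  have *: "1 - const_lp c * var_lp i * var_inv_lp j * const_lp q ^ l
      = 1 - var_lp i * var_inv_lp j * const_lp (c * q ^ l)" for l
  proof -
    have "const_lp (c * q ^ l) = const_lp c * const_lp (q ^ l)"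
      by (simp add: const_lp_def mult_single)
    then show ?thesis by (simp add: const_lp_power mult_ac)
  qed
  have "balanced n (\<lambda>k. \<Sum>l<N. of_bool (k = j)) (qpoch (const_lp q) (const_lp c * var_lp i * var_inv_lp j) N)"
    unfolding qpoch_def * by (rule balanced_prod) (rule balanced_linear_factor[OF assms])
  then show ?thesis by simp
qed

text \<open>On a product grid the weighted sum of a monomial is a product of one-variable sums. Each
  is 1 at exponent 0, and a negative exponent gives 0 by \<open>lagrange_powi_sum\<close>, so only
  the constant monomial survives.\<close>

lemma constant_term_interpolation:
  fixes p :: "'c::field laurent_mpoly"
  assumes "balanced n d p"
    and C: "\<And>i. i \<in> {1..n} \<Longrightarrow> finite (C i) \<and> 0 \<notin> C i \<and> card (C i) = Suc (d i)"
  shows "constant_term p = (\<Sum>c\<in>PiE {1..n} C. laurent_eval {1..n} c p /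
           (\<Prod>i=1..n. \<Prod>y\<in>C i - {c i}. 1 - y / c i))"
proof -
  let ?w = "\<lambda>i z. \<Prod>y\<in>C i - {z}. 1 - y / z"
  have coeff: "(\<Prod>i=1..n. \<Sum>z\<in>C i. z powi Poly_Mapping.lookup b i / ?w i z) = of_bool (b = 0)"
    if b: "b \<in> Poly_Mapping.keys p" for b
  proof (cases "b = 0")
    case True
    then show ?thesis using C lagrange_powi_sum[of "C i" "d i" 0 for i] by simp
  next
    case False
    have supp: "Poly_Mapping.keys b \<subseteq> {1..n}" and sum0: "(\<Sum>i=1..n. Poly_Mapping.lookup b i) = 0"
      and low: "\<And>i. - int (d i) \<le> Poly_Mapping.lookup b i"
      using assms(1) b by (auto simp: balanced_def)
    have "\<exists>i\<in>{1..n}. Poly_Mapping.lookup b i < 0"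
    proof (rule ccontr)
      assume "\<not> ?thesis"
      then have "\<forall>i\<in>{1..n}. Poly_Mapping.lookup b i = 0"
        using sum0 by (subst (asm) sum_nonneg_eq_0_iff) (auto simp: not_less)
      then have "Poly_Mapping.lookup b i = 0" for i
        using supp by (cases "i \<in> {1..n}") (auto simp: in_keys_iff)
      then have "b = 0" by (intro poly_mapping_eqI) simp
      then show False using False by simp
    qed
    then obtain i where i: "i \<in> {1..n}" "Poly_Mapping.lookup b i < 0" by blast
    then have "(\<Sum>z\<in>C i. z powi Poly_Mapping.lookup b i / ?w i z) = 0"
      using lagrange_powi_sum[of "C i" "d i" "Poly_Mapping.lookup b i"] C[OF i(1)] low by simp
    \<comment> \<open>One vanishing factor is enough, whatever positive exponents occur in the other
      coordinates.\<close>
    then show ?thesis using i(1) False by (auto intro!: prod_zero)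
  qed
  have "constant_term p = (\<Sum>b\<in>Poly_Mapping.keys p. Poly_Mapping.lookup p b * of_bool (b = 0))"
    by (auto simp: constant_term_def of_bool_def if_distrib in_keys_iff cong: if_cong)
  also have "\<dots> = (\<Sum>b\<in>Poly_Mapping.keys p. Poly_Mapping.lookup p b *
      (\<Sum>c\<in>PiE {1..n} C. \<Prod>i=1..n. c i powi Poly_Mapping.lookup b i / ?w i (c i)))"
  proof (rule sum.cong[OF refl])
    fix b assume b: "b \<in> Poly_Mapping.keys p"
    show "Poly_Mapping.lookup p b * of_bool (b = 0) = Poly_Mapping.lookup p b *
      (\<Sum>c\<in>PiE {1..n} C. \<Prod>i=1..n. c i powi Poly_Mapping.lookup b i / ?w i (c i))"
      unfolding coeff[OF b, symmetric] using C by (subst prod_sum_PiE) auto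
  qed
  also have "\<dots> = (\<Sum>c\<in>PiE {1..n} C. \<Sum>b\<in>Poly_Mapping.keys p. Poly_Mapping.lookup p b *
      (monom_eval {1..n} c b / (\<Prod>i=1..n. ?w i (c i))))"
    by (subst sum.swap) (simp add: sum_distrib_left prod_dividef monom_eval_def)
  also have "\<dots> = (\<Sum>c\<in>PiE {1..n} C. laurent_eval {1..n} c p / (\<Prod>i=1..n. ?w i (c i)))"
    by (simp add: laurent_eval_def sum_divide_distrib)
  finally show ?thesis .
qed

subsection \<open>Evaluation at the remaining point\<close>

lemma psum_Suc: "1 \<le> i \<Longrightarrow> psum a (Suc i) = psum a i + a i"
  by (simp add: psum_def)

lemma psum_1 [simp]: "psum a (Suc 0) = 0"
  by (simp add: psum_def)

lemma psum_mono: "i \<le> j \<Longrightarrow> psum a i \<le> psum a j"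
  unfolding psum_def by (rule sum_mono2) auto

lemma psum_add_le: "1 \<le> i \<Longrightarrow> i < j \<Longrightarrow> psum a i + a i \<le> psum a j"
  using psum_mono[of "Suc i" j a] by (simp add: psum_Suc)

text \<open>The blocks of length \<open>a j\<close> starting at \<open>psum a j\<close> are
  adjacent, so they tile one interval.\<close>

lemma prod_psum_blocks:
  fixes f :: "nat \<Rightarrow> 'c::comm_monoid_mult"
  assumes "1 \<le> k" "k \<le> N"
  shows "(\<Prod>j=k..<N. \<Prod>l<a j. f (psum a j + l)) = (\<Prod>s=psum a k..<psum a N. f s)"
  using assms(2)
proof (induction N rule: dec_induct)
  case base
  then show ?case by simp
next
  case (step N)
  have "(\<Prod>l<a N. f (psum a N + l)) = (\<Prod>s=psum a N..<psum a (Suc N). f s)"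
    using prod.shift_bounds_nat_ivl[of f 0 "psum a N" "a N"] step assms
    by (simp add: psum_Suc lessThan_atLeast0 add.commute)
  then show ?case using step psum_mono[of k N a] psum_mono[of N "Suc N" a]
    by (simp add: prod.atLeastLessThan_concat)
qed

lemma prod_telescope_divide:
  fixes f :: "nat \<Rightarrow> 'c::field"
  assumes "\<And>i. f i \<noteq> 0"
  shows "(\<Prod>i=1..k. f i / f (Suc i)) = f 1 / f (Suc k)"
  by (induction k) (simp_all add: assms)

lemma qpoch_Suc: "qpoch q t (Suc k) = qpoch q t k * (1 - t * q ^ k)"
  by (simp add: qpoch_def)

section \<open>q-products over a field in which the powers of \<open>q\<close> are nonzero and
  pairwise distinct\<close>

context
  fixes q :: "'c::field"
  assumes q0: "q \<noteq> 0" and q_power_neq_1: "\<And>k. k > 0 \<Longrightarrow> q ^ k \<noteq> 1"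
begin

lemma q_power_less_neq: "i < j \<Longrightarrow> q ^ i \<noteq> q ^ j"
  using q_power_neq_1[of "j - i"] q0 by (auto simp: power_diff)

lemma q_power_eq_iff: "q ^ i = q ^ j \<longleftrightarrow> i = j"
  using q_power_less_neq[of i j] q_power_less_neq[of j i] by (cases i j rule: linorder_cases) auto

lemma qpoch_q_nonzero: "qpoch q q k \<noteq> 0"
  using q_power_neq_1 by (auto simp: qpoch_def simp flip: power_Suc)

text \<open>The nodes above \<open>q ^ s\<close> give a Pochhammer symbol. Those below are left as
  they stand, because they cancel against \<open>column_product\<close>.\<close>

lemma node_product:
  assumes "s \<le> d"
  shows "(\<Prod>y\<in>(\<lambda>k. q ^ k) ` {..d} - {q ^ s}. 1 - y / q ^ s)
    = (\<Prod>k<s. 1 - q ^ k / q ^ s) * qpoch q q (d - s)"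
proof -
  have inj: "inj_on (\<lambda>k. q ^ k) A" for A by (auto simp: inj_on_def q_power_eq_iff)
  have "(\<lambda>k. q ^ k) ` {..d} - {q ^ s} = (\<lambda>k. q ^ k) ` ({..<s} \<union> {Suc s..<Suc d})"
    using assms by (auto simp: q_power_eq_iff image_iff)
  then have "(\<Prod>y\<in>(\<lambda>k. q ^ k) ` {..d} - {q ^ s}. 1 - y / q ^ s)
      = (\<Prod>k\<in>{..<s} \<union> {Suc s..<Suc d}. 1 - q ^ k / q ^ s)"
    by (simp add: prod.reindex[OF inj])
  also have "\<dots> = (\<Prod>k<s. 1 - q ^ k / q ^ s) * (\<Prod>k=Suc s..<Suc d. 1 - q ^ k / q ^ s)"
    by (rule prod.union_disjoint) auto
  also have "(\<Prod>k=Suc s..<Suc d. 1 - q ^ k / q ^ s) = (\<Prod>l=0..<d - s. 1 - q ^ (l + Suc s) / q ^ s)"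
    using prod.shift_bounds_nat_ivl[of "\<lambda>k. 1 - q ^ k / q ^ s" 0 "Suc s" "d - s"] assms by simp
  also have "\<dots> = qpoch q q (d - s)"
    using q0 by (simp add: qpoch_def lessThan_atLeast0 power_add)
  finally show ?thesis .
qed

lemma node_product_nonzero: "(\<Prod>k<s. 1 - q ^ k / q ^ s) \<noteq> 0"
  using q0 by (auto simp: q_power_eq_iff)

text \<open>For fixed \<open>j\<close> the exponents \<open>psum a i + l\<close> with
  \<open>i < j\<close> and \<open>l < a i\<close> run exactly once through all numbers below
  \<open>psum a j\<close>.\<close>

lemma column_product:
  assumes "1 \<le> j"
  shows "(\<Prod>i=1..<j. qpoch q (q ^ psum a i * inverse (q ^ psum a j)) (a i))
    = (\<Prod>s<psum a j. 1 - q ^ s / q ^ psum a j)"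
  using prod_psum_blocks[of 1 j "\<lambda>s. 1 - q ^ s / q ^ psum a j" a] assms
  by (simp add: qpoch_def power_add field_simps lessThan_atLeast0)

text \<open>For fixed \<open>i\<close> the blocks of the later \<open>j\<close> tile the range from
  \<open>psum a (Suc i)\<close> to \<open>A\<close>; the factor \<open>qpoch q q (a i)\<close> fills
  in the missing beginning. For \<open>i \<le> m\<close> the raised \<open>astar\<close> at
  \<open>j = n\<close> appends one factor at \<open>A\<close>.\<close>

lemma row_product:
  fixes a :: "nat \<Rightarrow> nat"
  assumes "i \<in> {1..n}" "m < n"
  defines "A \<equiv> psum a (Suc n)"
  shows "(\<Prod>j=Suc i..<Suc n. qpoch q (q * q ^ psum a j * inverse (q ^ psum a i)) (astar m n a i j)) * qpoch q q (a i)
    = qpoch q q (A - psum a i) * (if i \<le> m then 1 - q ^ Suc (A - psum a i) else 1)"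
proof -
  let ?f = "\<lambda>s. 1 - q ^ Suc s / q ^ psum a i"
  let ?t = "\<lambda>j. q * q ^ psum a j * inverse (q ^ psum a i)"
  have le: "psum a i + a i \<le> A" using assms psum_add_le[of i "Suc n" a] by simp
  have An: "A = psum a n + a n" using assms by (simp add: psum_Suc)
  have f: "1 - ?t j * q ^ l = ?f (psum a j + l)" for j l
    by (simp add: power_add field_simps)
  have "(\<Prod>j=Suc i..<Suc n. qpoch q (?t j) (astar m n a i j))
      = (\<Prod>j=Suc i..<Suc n. qpoch q (?t j) (a j) * (if j = n \<and> i \<le> m then ?f A else 1))"
    by (rule prod.cong) (auto simp: astar_def qpoch_Suc f An)
  \<comment> \<open>By \<open>m < n\<close>, an \<open>i \<le> m\<close> is smaller than
    \<open>n\<close>, so \<open>j = n\<close> does occur in the range.\<close>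
  also have "\<dots> = (\<Prod>j=Suc i..<Suc n. qpoch q (?t j) (a j)) * (if i \<le> m then ?f A else 1)"
    using assms by (simp add: prod.distrib prod.delta)
  also have "(\<Prod>j=Suc i..<Suc n. qpoch q (?t j) (a j)) = (\<Prod>s=psum a (Suc i)..<A. ?f s)"
    using prod_psum_blocks[of "Suc i" "Suc n" ?f a] assms by (simp only: qpoch_def f) simp
  also have "\<dots> = (\<Prod>l=a i..<A - psum a i. ?f (l + psum a i))"
    using prod.shift_bounds_nat_ivl[of ?f "a i" "psum a i" "A - psum a i"] le assms
    by (simp add: psum_Suc add.commute)
  also have "\<dots> = (\<Prod>l=a i..<A - psum a i. 1 - q * q ^ l)"
    using q0 by (simp add: power_add)
  finally have 1: "(\<Prod>j=Suc i..<Suc n. qpoch q (?t j) (astar m n a i j))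
     = (\<Prod>l=a i..<A - psum a i. 1 - q * q ^ l) * (if i \<le> m then ?f A else 1)" .
  have 2: "qpoch q q (A - psum a i) = qpoch q q (a i) * (\<Prod>l=a i..<A - psum a i. 1 - q * q ^ l)"
    using prod.atLeastLessThan_concat[of 0 "a i" "A - psum a i" "\<lambda>l. 1 - q * q ^ l"] le
    by (simp add: qpoch_def lessThan_atLeast0)
  have 3: "?f A = 1 - q ^ Suc (A - psum a i)"
    using q0 le by (simp add: power_diff)
  show ?thesis unfolding 1 2 3 by simp
qed

lemma q_dyson_constant_term:
  fixes a :: "nat \<Rightarrow> nat"
  assumes "m < n"
  defines "A \<equiv> (\<Sum>v=1..n. a v)"
  shows "constant_term
      (\<Prod>(i, j) \<in> {(i, j). 1 \<le> i \<and> i < j \<and> j \<le> n}.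
          qpoch (const_lp q) (var_lp i * var_inv_lp j) (a i)
        * qpoch (const_lp q) (const_lp q * var_lp j * var_inv_lp i) (astar m n a i j))
    = (1 - q ^ (1 + A)) / (1 - q ^ (1 + (\<Sum>v=m+1..n. a v)))
      * (qpoch q q A / (\<Prod>i=1..n. qpoch q q (a i)))"
    (is "constant_term (\<Prod>(i, j)\<in>?P. ?X i j * ?Y i j) = _")
proof -
  define F where "F = (\<Prod>(i, j)\<in>?P. ?X i j * ?Y i j)"
  define d where "d i = A - a i + of_bool (i \<le> m)" for i
  define C where "C i = (\<lambda>k. q ^ k) ` {..d i}" for i
  \<comment> \<open>The restricted abstraction makes \<open>c0\<close> undefined outside
    \<open>{1..n}\<close>, as membership in \<open>PiE\<close> demands.\<close>
  define c0 where "c0 = (\<lambda>i\<in>{1..n}. q ^ psum a i)"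
  let ?w = "\<lambda>c. \<Prod>i=1..n. \<Prod>y\<in>C i - {c i}. 1 - y / c i"
  have P_Sigma: "?P = (SIGMA i:{1..n}. {Suc i..<Suc n})" by auto
  have finP: "finite ?P" unfolding P_Sigma by auto
  have A_psum: "A = psum a (Suc n)"
    by (simp add: A_def psum_def atLeastLessThanSuc_atLeastAtMost)
  have le_A: "psum a i + a i \<le> A" if "i \<in> {1..n}" for i
    using psum_add_le[of i "Suc n" a] that by (simp add: A_psum)
  have n: "n \<in> {1..n}" using assms by simp
  \<comment> \<open>\<open>x k\<close> is inverted in the first symbol of each pair
    \<open>(i, k)\<close> and in the second symbol of each pair \<open>(k, j)\<close>; the extra 1
    for \<open>k \<le> m\<close> comes from \<open>astar\<close> at \<open>j = n\<close>.\<close>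
  have deg: "(\<Sum>(i, j)\<in>?P. a i * of_bool (k = j) + astar m n a i j * of_bool (k = i)) = d k"
    if k: "k \<in> {1..n}" for k
  proof -
    have "(\<Sum>(i, j)\<in>?P. a i * of_bool (k = j) + astar m n a i j * of_bool (k = i))
        = (\<Sum>i=1..n. \<Sum>j=Suc i..<Suc n. a i * of_bool (k = j) + astar m n a i j * of_bool (k = i))"
      unfolding P_Sigma by (subst sum.Sigma) auto
    also have "\<dots> = (\<Sum>i=1..n. \<Sum>j=Suc i..<Suc n. a i * of_bool (k = j))
        + (\<Sum>i=1..n. of_bool (k = i) * (\<Sum>j=Suc i..<Suc n. astar m n a i j))"
      by (simp only: sum.distrib sum_distrib_left mult.commute)
    also have "(\<Sum>i=1..n. \<Sum>j=Suc i..<Suc n. a i * of_bool (k = j)) = (\<Sum>i=1..n. if i < k then a i else 0)"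
    proof (rule sum.cong[OF refl])
      fix i
      have "(\<Sum>j=Suc i..<Suc n. a i * of_bool (k = j)) = (\<Sum>j=Suc i..<Suc n. if j = k then a i else 0)"
        by (rule sum.cong) auto
      also have "\<dots> = (if i < k then a i else 0)"
        using k by (simp only: sum.delta finite_atLeastLessThan) auto
      finally show "(\<Sum>j=Suc i..<Suc n. a i * of_bool (k = j)) = (if i < k then a i else 0)" .
    qed
    also have "\<dots> = sum a {1..<k}"
      using k by (subst sum.inter_filter[symmetric]) (auto intro!: sum.cong)
    also have "(\<Sum>i=1..n. of_bool (k = i) * (\<Sum>j=Suc i..<Suc n. astar m n a i j))
        = (\<Sum>j=Suc k..<Suc n. astar m n a k j)"
      using k by (subst sum.remove[of _ k]) auto
    also have "\<dots> = (\<Sum>j=Suc k..<Suc n. a j + (if j = n then of_bool (k \<le> m) else 0))"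
      by (rule sum.cong) (auto simp: astar_def)
    also have "\<dots> = sum a {Suc k..<Suc n} + of_bool (k \<le> m)"
      using k assms by (auto simp: sum.distrib)
    also have "sum a {1..<k} + (sum a {Suc k..<Suc n} + of_bool (k \<le> m)) = d k"
    proof -
      have "A = sum a {1..<k} + sum a {k..<Suc n}"
        unfolding A_psum psum_def using k by (simp add: sum.atLeastLessThan_concat)
      also have "sum a {k..<Suc n} = a k + sum a {Suc k..<Suc n}"
        using k by (subst sum.atLeast_Suc_lessThan) auto
      finally show ?thesis by (simp add: d_def)
    qed
    finally show ?thesis .
  qed
  have bal: "balanced n d F"
  proof -
    have "balanced n (\<lambda>k. \<Sum>x\<in>?P. (case x of (i, j) \<Rightarrow> \<lambda>k. a i * of_bool (k = j) + astar m n a i j * of_bool (k = i)) k) F"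
      unfolding F_def
    proof (rule balanced_prod)
      fix x assume "x \<in> ?P"
      then obtain i j where x: "x = (i, j)" "1 \<le> i" "i < j" "j \<le> n" by auto
      have "balanced n (\<lambda>k. a i * of_bool (k = j)) (?X i j)"
        using balanced_qpoch[of i n j "a i" q 1] x by (simp add: const_lp_def)
      moreover have "balanced n (\<lambda>k. astar m n a i j * of_bool (k = i)) (?Y i j)"
        using balanced_qpoch[of j n i "astar m n a i j" q q] x by simp
      ultimately show "balanced n (case x of (i, j) \<Rightarrow> \<lambda>k. a i * of_bool (k = j) + astar m n a i j * of_bool (k = i))
          (case x of (i, j) \<Rightarrow> ?X i j * ?Y i j)"
        using balanced_mult unfolding x(1) prod.case by blast
    qed
    then have bal: "balanced n (\<lambda>k. \<Sum>(i, j)\<in>?P. a i * of_bool (k = j) + astar m n a i j * of_bool (k = i)) F"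
      by (simp add: case_prod_unfold)
    show ?thesis
      unfolding balanced_def
    proof (intro ballI conjI allI)
      fix b k assume b: "b \<in> Poly_Mapping.keys F"
      show "Poly_Mapping.keys b \<subseteq> {1..n}" "(\<Sum>i=1..n. Poly_Mapping.lookup b i) = 0"
        using bal b by (auto simp: balanced_def)
      show "- int (d k) \<le> Poly_Mapping.lookup b k"
      \<comment> \<open>The degree count \<open>deg\<close> covers only indices in
        \<open>{1..n}\<close>; elsewhere the exponent is 0.\<close>
      proof (cases "k \<in> {1..n}")
        case True
        show ?thesis using bal b unfolding balanced_def deg[OF True, symmetric] by blast
      next
        case False
        then have "Poly_Mapping.lookup b k = 0"
          using \<open>Poly_Mapping.keys b \<subseteq> {1..n}\<close> by (auto simp: in_keys_iff)
        then show ?thesis by simp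
      qed
    qed
  qed
  have eval: "laurent_eval {1..n} c F = (\<Prod>(i, j)\<in>?P. qpoch q (c i * inverse (c j)) (a i)
      * qpoch q (q * c j * inverse (c i)) (astar m n a i j))"
    if "\<And>i. i \<in> {1..n} \<Longrightarrow> c i \<noteq> 0" for c
  proof -
    have hom: "laurent_eval {1..n} c (p * r) = laurent_eval {1..n} c p * laurent_eval {1..n} c r"
      "laurent_eval {1..n} c (qpoch (const_lp q) t k) = qpoch q (laurent_eval {1..n} c t) k" for p r t k
      by (rule laurent_eval_mult, erule that) (rule laurent_eval_qpoch, erule that)
    have "laurent_eval {1..n} c (?X i j * ?Y i j) = qpoch q (c i * inverse (c j)) (a i)
        * qpoch q (q * c j * inverse (c i)) (astar m n a i j)" if "(i, j) \<in> ?P" for i j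
      using that by (simp only: hom laurent_eval_const) (simp add: laurent_eval_var)
    then show ?thesis
      unfolding F_def by (subst laurent_eval_prod) (use that in \<open>auto intro!: prod.cong\<close>)
  qed
  have vanish: "laurent_eval {1..n} c F = 0" if c: "c \<in> PiE {1..n} C" "c \<noteq> c0" for c
  proof (rule ccontr)
    assume nz: "laurent_eval {1..n} c F \<noteq> 0"
    have "\<forall>i\<in>{1..n}. \<exists>k\<le>d i. c i = q ^ k" using c by (auto simp: PiE_iff C_def)
    then obtain al where al: "\<And>i. i \<in> {1..n} \<Longrightarrow> al i \<le> d i" "\<And>i. i \<in> {1..n} \<Longrightarrow> c i = q ^ al i"
      by metis
    have nz': "qpoch q (q ^ al i * inverse (q ^ al j)) (a i) \<noteq> 0"
      "qpoch q (q * q ^ al j * inverse (q ^ al i)) (astar m n a i j) \<noteq> 0"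
      if "1 \<le> i" "i < j" "j \<le> n" for i j
    proof -
      have "(i, j) \<in> ?P" using that by simp
      moreover have "(\<Prod>(i, j)\<in>?P. qpoch q (c i * inverse (c j)) (a i)
        * qpoch q (q * c j * inverse (c i)) (astar m n a i j)) \<noteq> 0"
        using nz al(2) q0 by (subst (asm) eval) auto
      ultimately have "qpoch q (c i * inverse (c j)) (a i)
        * qpoch q (q * c j * inverse (c i)) (astar m n a i j) \<noteq> 0"
        by (subst (asm) prod_zero_iff[OF finP]) (metis (no_types, lifting) old.prod.case)
      then show "qpoch q (q ^ al i * inverse (q ^ al j)) (a i) \<noteq> 0"
        "qpoch q (q * q ^ al j * inverse (q ^ al i)) (astar m n a i j) \<noteq> 0"
        using al(2)[of i] al(2)[of j] that by auto
    qed
    have "al k = psum a k" if "k \<in> {1..n}" for k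
    proof (rule separated_exponents_unique[OF assms(1) _ _ that])
      fix i j assume ij: "1 \<le> i" "i < j" "j \<le> n"
      show "al i + a i \<le> al j \<or> al j + astar m n a i j + 1 \<le> al i"
      proof (rule ccontr)
        assume neg: "\<not> ?thesis"
        show False
        \<comment> \<open>Each case names the factor that would vanish: index
          \<open>al j - al i\<close> in the first symbol, and \<open>al i - al j - 1\<close> in the
          second, shifted by its leading \<open>q\<close>.\<close>
        proof (cases "al i \<le> al j")
          case True
          then have "1 - q ^ al i * inverse (q ^ al j) * q ^ (al j - al i) = 0"
            using q0 by (simp add: power_diff)
          moreover have "al j - al i < a i" using neg True by auto
          ultimately have "qpoch q (q ^ al i * inverse (q ^ al j)) (a i) = 0"
            unfolding qpoch_def by (intro prod_zero) auto
          then show ?thesis using nz' ij by simp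
        next
          case False
          then have "q * q ^ al j * q ^ (al i - al j - 1) = q ^ al i"
            by (simp flip: power_Suc power_add)
          then have "1 - q * q ^ al j * inverse (q ^ al i) * q ^ (al i - al j - 1) = 0"
            using q0 by (simp add: field_simps)
          moreover have "al i - al j - 1 < astar m n a i j" using neg False by auto
          ultimately have "qpoch q (q * q ^ al j * inverse (q ^ al i)) (astar m n a i j) = 0"
            unfolding qpoch_def by (intro prod_zero) auto
          then show ?thesis using nz' ij by simp
        qed
      qed
    next
      fix i assume i: "i \<in> {1..n}"
      show "al i + a i \<le> (\<Sum>v=1..n. a v) + of_bool (i \<le> m)"
        using al(1)[OF i] le_A[OF i] by (simp add: d_def A_def)
    qed
    then have "c = c0"
      using c(1) al(2) by (intro ext) (auto simp: c0_def PiE_iff extensional_def)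
    then show False using c(2) by simp
  qed
  have psum_le_d: "psum a i \<le> d i" if "i \<in> {1..n}" for i
    using le_A[OF that] by (simp add: d_def)
  have c0_mem: "c0 \<in> PiE {1..n} C"
    using psum_le_d by (auto simp: c0_def C_def)
  have finC: "finite (C i)" for i by (simp add: C_def)
  have "constant_term F = (\<Sum>c\<in>PiE {1..n} C. laurent_eval {1..n} c F / ?w c)"
  proof (rule constant_term_interpolation[OF bal])
    fix i
    have "inj_on (\<lambda>k. q ^ k) {..d i}" by (auto simp: inj_on_def q_power_eq_iff)
    then show "finite (C i) \<and> 0 \<notin> C i \<and> card (C i) = Suc (d i)"
      using q0 by (auto simp: C_def card_image)
  qed
  also have "\<dots> = laurent_eval {1..n} c0 F / ?w c0"
    using c0_mem finC vanish
    by (subst sum.remove[of _ c0]) (auto intro!: finite_PiE sum.neutral)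
  also have "laurent_eval {1..n} c0 F = (\<Prod>(i, j)\<in>?P. qpoch q (q ^ psum a i * inverse (q ^ psum a j)) (a i))
      * (\<Prod>(i, j)\<in>?P. qpoch q (q * q ^ psum a j * inverse (q ^ psum a i)) (astar m n a i j))"
    unfolding prod.distrib[symmetric]
    by (subst eval) (auto simp: c0_def q0 intro!: prod.cong)
  \<comment> \<open>The first symbols are grouped by the larger index for
    \<open>column_product\<close>, the second ones by the smaller index for
    \<open>row_product\<close>.\<close>
  also have "(\<Prod>(i, j)\<in>?P. qpoch q (q ^ psum a i * inverse (q ^ psum a j)) (a i))
      = (\<Prod>(j, i)\<in>(SIGMA j:{1..n}. {1..<j}). qpoch q (q ^ psum a i * inverse (q ^ psum a j)) (a i))"
    by (rule prod.reindex_bij_witness[of _ prod.swap prod.swap]) auto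
  also have "\<dots> = (\<Prod>j=1..n. \<Prod>i=1..<j. qpoch q (q ^ psum a i * inverse (q ^ psum a j)) (a i))"
    by (subst prod.Sigma) auto
  also have "\<dots> = (\<Prod>i=1..n. \<Prod>s<psum a i. 1 - q ^ s / q ^ psum a i)"
    by (rule prod.cong[OF refl], rule column_product) simp
  also have "(\<Prod>(i, j)\<in>?P. qpoch q (q * q ^ psum a j * inverse (q ^ psum a i)) (astar m n a i j))
      = (\<Prod>i=1..n. \<Prod>j=Suc i..<Suc n. qpoch q (q * q ^ psum a j * inverse (q ^ psum a i)) (astar m n a i j))"
    unfolding P_Sigma by (subst prod.Sigma) auto
  also have "\<dots> = (\<Prod>i=1..n. qpoch q q (A - psum a i) * (if i \<le> m then 1 - q ^ Suc (A - psum a i) else 1)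
      / qpoch q q (a i))"
    by (rule prod.cong[OF refl])
      (use row_product[OF _ assms(1), of _ a] qpoch_q_nonzero in \<open>simp add: A_psum field_simps del: power_Suc\<close>)
  also have "?w c0 = (\<Prod>i=1..n. (\<Prod>s<psum a i. 1 - q ^ s / q ^ psum a i) *
      (qpoch q q (A - psum a (Suc i)) * (if i \<le> m then 1 - q ^ Suc (A - psum a (Suc i)) else 1)))"
  proof (rule prod.cong[OF refl])
    fix i assume i: "i \<in> {1..n}"
    \<comment> \<open>The additional node for \<open>i \<le> m\<close> lengthens the Pochhammer
      symbol of \<open>node_product\<close> by one factor.\<close>
    have "d i - psum a i = A - psum a (Suc i) + of_bool (i \<le> m)"
      using le_A[OF i] i by (simp add: d_def psum_Suc)
    then show "(\<Prod>y\<in>C i - {c0 i}. 1 - y / c0 i) = (\<Prod>s<psum a i. 1 - q ^ s / q ^ psum a i) *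
      (qpoch q q (A - psum a (Suc i)) * (if i \<le> m then 1 - q ^ Suc (A - psum a (Suc i)) else 1))"
      using node_product[OF psum_le_d[OF i]] i by (simp add: C_def c0_def qpoch_Suc)
  qed
  \<comment> \<open>The products over lower nodes cancel, leaving two quotients that telescope in
    \<open>i\<close>.\<close>
  also have "(\<Prod>i=1..n. \<Prod>s<psum a i. 1 - q ^ s / q ^ psum a i) *
      (\<Prod>i=1..n. qpoch q q (A - psum a i) * (if i \<le> m then 1 - q ^ Suc (A - psum a i) else 1) / qpoch q q (a i)) /
      (\<Prod>i=1..n. (\<Prod>s<psum a i. 1 - q ^ s / q ^ psum a i) *
      (qpoch q q (A - psum a (Suc i)) * (if i \<le> m then 1 - q ^ Suc (A - psum a (Suc i)) else 1)))
    = (\<Prod>i=1..n. qpoch q q (A - psum a i) / qpoch q q (A - psum a (Suc i)) *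
        (if i \<le> m then (1 - q ^ Suc (A - psum a i)) / (1 - q ^ Suc (A - psum a (Suc i))) else 1)
        / qpoch q q (a i))"
    unfolding prod.distrib[symmetric] prod_dividef[symmetric]
    using node_product_nonzero by (intro prod.cong) auto
  also have "\<dots> = (\<Prod>i=1..n. qpoch q q (A - psum a i) / qpoch q q (A - psum a (Suc i))) *
      (\<Prod>i=1..n. if i \<le> m then (1 - q ^ Suc (A - psum a i)) / (1 - q ^ Suc (A - psum a (Suc i))) else 1)
      / (\<Prod>i=1..n. qpoch q q (a i))"
    by (simp only: prod_dividef prod.distrib)
  \<comment> \<open>The ends are \<open>psum a 1 = 0\<close> and
    \<open>A - psum a (Suc n) = 0\<close>, the latter giving an empty symbol.\<close>
  also have "(\<Prod>i=1..n. qpoch q q (A - psum a i) / qpoch q q (A - psum a (Suc i))) = qpoch q q A"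
    using prod_telescope_divide[of "\<lambda>i. qpoch q q (A - psum a i)" n] qpoch_q_nonzero
    by (simp add: A_psum qpoch_def)
  also have "(\<Prod>i=1..n. if i \<le> m then (1 - q ^ Suc (A - psum a i)) / (1 - q ^ Suc (A - psum a (Suc i))) else 1)
     = (\<Prod>i=1..m. (1 - q ^ Suc (A - psum a i)) / (1 - q ^ Suc (A - psum a (Suc i))))"
    using assms(1) by (intro prod.mono_neutral_cong_right) auto
  \<comment> \<open>This product stops at \<open>m\<close>, so the denominator that remains carries
    the sum of the \<open>a v\<close> with \<open>v > m\<close>.\<close>
  also have "\<dots> = (1 - q ^ Suc A) / (1 - q ^ Suc (A - psum a (Suc m)))"
    using prod_telescope_divide[of "\<lambda>i. 1 - q ^ Suc (A - psum a i)" m] q_power_neq_1[of "Suc k" for k]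
    by (simp del: power_Suc)
  also have "A - psum a (Suc m) = (\<Sum>v=m+1..n. a v)"
  proof -
    have "psum a (Suc m) + (\<Sum>v=Suc m..<Suc n. a v) = A"
      unfolding A_psum psum_def using assms(1) by (intro sum.atLeastLessThan_concat) auto
    then show ?thesis by (simp add: atLeastLessThanSuc_atLeastAtMost)
  qed
  finally show ?thesis by (simp add: F_def mult.commute)
qed

end

section \<open>Specialisation to the indeterminate of the rational function field\<close>

lemma qvar_power: "qvar ^ k = Fract (monom 1 k) 1"
  by (induction k) (simp_all add: qvar_def One_fract_def monom_Suc)

lemma qvar_power_neq_1: "k > 0 \<Longrightarrow> qvar ^ k \<noteq> 1"
  by (simp add: qvar_power One_fract_def eq_fract monom_eq_1_iff)

theorem theorem5:
  fixes m n :: nat and a :: "nat \<Rightarrow> nat"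
  assumes "m < n" and "n \<ge> 1"
  shows "constant_term
      (\<Prod>(i, j) \<in> {(i, j). 1 \<le> i \<and> i < j \<and> j \<le> n}.
          qpoch (const_lp qvar) (var_lp i * var_inv_lp j) (a i)
        * qpoch (const_lp qvar) (const_lp qvar * var_lp j * var_inv_lp i) (astar m n a i j))
    = (1 - qvar ^ (1 + (\<Sum>v=1..n. a v))) / (1 - qvar ^ (1 + (\<Sum>v=m+1..n. a v)))
      * qmultinomial n a"
  unfolding qmultinomial_def
proof (rule q_dyson_constant_term[OF _ _ assms(1)])
  show "qvar \<noteq> 0" by (simp add: qvar_def Zero_fract_def eq_fract)
qed (rule qvar_power_neq_1)

end
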